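(* Let $T\ge 2$, let $L,l$ be integers with $1\le L\le T-1$ and $1\le l\le T-1$, let $0\le\underline{p}\le\overline{p}$ and $0\le\underline{r}\le\overline{r}$. Consider, for $\bm{p}=(p_1,\dots,p_T)$, $\bm{r}=(r_1,\dots,r_T)$, $\bm{x}=(x_1,\dots,x_T)$, $\bm{u}=(u_2,\dots,u_T)$, the constraints (1) $u_t\ge x_t-x_{t-1}$ for all $t\in[2,T]$; (2) $\sum_{i=t-L+1}^{t}u_i\le x_t$ for all $t\in[L+1,T]$; (3) $\sum_{i=t-l+1}^{t}u_i\le 1-x_{t-l}$ for all $t\in[l+1,T]$; (4) $u_t\ge 0$ for all $t\in[2,T]$; (5) $x_t\underline{p}\le p_t$ for all $t\in[1,T]$; (6) $p_t+r_t\le x_t\overline{p}$ for all $t\in[1,T]$; (7) $x_t\underline{r}\le r_t\le x_t\overline{r}$ for all $t\in[1,T]$. Let $$\mathcal{X}=\{\bm{p}\in\mathbb{R}^T,\ \bm{r}\in\mathbb{R}^T,\ \bm{x}\in\{0,1\}^T,\ \bm{u}\in\{0,1\}^{T-1}\mid (1),(2),(3),(5),(6),(7)\}.$$ Then $$\mathrm{conv}(\mathcal{X})=\{\bm{p}\in\mathbb{R}^T,\ \bm{r}\in\mathbb{R}^T,\ \bm{x}\in\mathbb{R}^T,\ \bm{u}\in\mathbb{R}^{T-1}\mid (1),(2),(3),(4),(5),(6),(7)\}.$$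
   Context: The data describe a single generating unit over $T$ periods providing energy $p_t$ and upward spinning reserve $r_t$: $x_t$ is the commitment variable, $u_t$ the start-up variable (defined for $t=2,\dots,T$), $L$ and $l$ the minimum up and down times, $\underline{p},\overline{p}$ the generation limits, $\underline{r},\overline{r}$ the limits on reserve. Index ranges $[a,b]$ denote integers. $\mathrm{conv}(\cdot)$ is the convex hull. *)

theory Defs
  imports "HOL-Analysis.Analysis" "HOL-Analysis.Finite_Function_Topology"
begin

text \<open>Since the horizon \<open>T\<close> is a number, vectors indexed by a finite set of periods \<open>I\<close> are
  rendered as finitely supported functions vanishing outside \<open>I\<close>. Their type is a real vector
  space with componentwise operations, so the library's \<open>convex hull\<close> applies to tuples of them.\<close>

definition real_vecs :: "nat set \<Rightarrow> (nat \<Rightarrow>\<^sub>0 real) set" where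
  "real_vecs I = {v. Poly_Mapping.keys v \<subseteq> I}"

definition binary_vecs :: "nat set \<Rightarrow> (nat \<Rightarrow>\<^sub>0 real) set" where
  "binary_vecs I = {v \<in> real_vecs I. \<forall>t\<in>I. Poly_Mapping.lookup v t \<in> {0, 1}}"

type_synonym schedule =
  "(nat \<Rightarrow>\<^sub>0 real) \<times> (nat \<Rightarrow>\<^sub>0 real) \<times> (nat \<Rightarrow>\<^sub>0 real) \<times> (nat \<Rightarrow>\<^sub>0 real)"

abbreviation component :: "(nat \<Rightarrow>\<^sub>0 real) \<Rightarrow> nat \<Rightarrow> real" (infixl "\<bullet>\<bullet>" 95) where
  "v \<bullet>\<bullet> t \<equiv> Poly_Mapping.lookup v t"

text \<open>In the following, natural-number subtraction never truncates, because the range of \<open>t\<close>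
  guarantees \<open>t > L\<close> and \<open>t > l\<close>, respectively (and \<open>t > 1\<close> for start-up).\<close>

definition startup_logic :: "nat \<Rightarrow> (nat \<Rightarrow>\<^sub>0 real) \<Rightarrow> (nat \<Rightarrow>\<^sub>0 real) \<Rightarrow> bool" where
  "startup_logic T x u \<longleftrightarrow> (\<forall>t\<in>{2..T}. u \<bullet>\<bullet> t \<ge> x \<bullet>\<bullet> t - x \<bullet>\<bullet> (t - 1))"

definition min_up_time :: "nat \<Rightarrow> nat \<Rightarrow> (nat \<Rightarrow>\<^sub>0 real) \<Rightarrow> (nat \<Rightarrow>\<^sub>0 real) \<Rightarrow> bool" where
  "min_up_time T L x u \<longleftrightarrow> (\<forall>t\<in>{L+1..T}. (\<Sum>i = t - L + 1..t. u \<bullet>\<bullet> i) \<le> x \<bullet>\<bullet> t)"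

definition min_down_time :: "nat \<Rightarrow> nat \<Rightarrow> (nat \<Rightarrow>\<^sub>0 real) \<Rightarrow> (nat \<Rightarrow>\<^sub>0 real) \<Rightarrow> bool" where
  "min_down_time T l x u \<longleftrightarrow>
     (\<forall>t\<in>{l+1..T}. (\<Sum>i = t - l + 1..t. u \<bullet>\<bullet> i) \<le> 1 - x \<bullet>\<bullet> (t - l))"

definition startup_nonneg :: "nat \<Rightarrow> (nat \<Rightarrow>\<^sub>0 real) \<Rightarrow> bool" where
  "startup_nonneg T u \<longleftrightarrow> (\<forall>t\<in>{2..T}. u \<bullet>\<bullet> t \<ge> 0)"

definition min_generation :: "nat \<Rightarrow> real \<Rightarrow> (nat \<Rightarrow>\<^sub>0 real) \<Rightarrow> (nat \<Rightarrow>\<^sub>0 real) \<Rightarrow> bool" where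
  "min_generation T pmin p x \<longleftrightarrow> (\<forall>t\<in>{1..T}. x \<bullet>\<bullet> t * pmin \<le> p \<bullet>\<bullet> t)"

definition max_capacity ::
  "nat \<Rightarrow> real \<Rightarrow> (nat \<Rightarrow>\<^sub>0 real) \<Rightarrow> (nat \<Rightarrow>\<^sub>0 real) \<Rightarrow> (nat \<Rightarrow>\<^sub>0 real) \<Rightarrow> bool" where
  "max_capacity T pmax p r x \<longleftrightarrow> (\<forall>t\<in>{1..T}. p \<bullet>\<bullet> t + r \<bullet>\<bullet> t \<le> x \<bullet>\<bullet> t * pmax)"

definition reserve_limits ::
  "nat \<Rightarrow> real \<Rightarrow> real \<Rightarrow> (nat \<Rightarrow>\<^sub>0 real) \<Rightarrow> (nat \<Rightarrow>\<^sub>0 real) \<Rightarrow> bool" where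
  "reserve_limits T rmin rmax r x \<longleftrightarrow>
     (\<forall>t\<in>{1..T}. x \<bullet>\<bullet> t * rmin \<le> r \<bullet>\<bullet> t \<and> r \<bullet>\<bullet> t \<le> x \<bullet>\<bullet> t * rmax)"

definition feasible_schedules ::
  "nat \<Rightarrow> nat \<Rightarrow> nat \<Rightarrow> real \<Rightarrow> real \<Rightarrow> real \<Rightarrow> real \<Rightarrow> schedule set" where
  "feasible_schedules T L l pmin pmax rmin rmax =
     {(p, r, x, u). p \<in> real_vecs {1..T} \<and> r \<in> real_vecs {1..T} \<and>
        x \<in> binary_vecs {1..T} \<and> u \<in> binary_vecs {2..T} \<and>
        startup_logic T x u \<and> min_up_time T L x u \<and> min_down_time T l x u \<and>
        min_generation T pmin p x \<and> max_capacity T pmax p r x \<and>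
        reserve_limits T rmin rmax r x}"

end

theory Submission
  imports Defs
begin

text \<open>Let \<open>U t = x 1 + (\<Sum>i=2..t. u i)\<close> and \<open>V t = U t - x t\<close> count the start-ups and the
  shut-downs up to period \<open>t\<close>. In these variables the constraints (1)--(4) only bound differences of
  two variables by \<open>0\<close> or \<open>1\<close>: \<open>U\<close> and \<open>V\<close> are nondecreasing, \<open>V t \<le> U (t - L)\<close> and
  \<open>U t \<le> 1 + V (t - l)\<close>. Such constraints survive replacing every variable \<open>y\<close> by
  \<open>\<lceil>y - \<theta>\<rceil>\<close>, and the average of \<open>\<lceil>y - \<theta>\<rceil>\<close> over \<open>\<theta> \<in> [0, 1)\<close> is \<open>y\<close>. Since only finitely many
  variables occur, this average is a finite convex combination of binary points. The power and
  reserve are distributed in proportion to the commitment, as \<open>p t / x t\<close> and \<open>r t / x t\<close>.\<close>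

section \<open>Averages of shifted ceilings\<close>

text \<open>Each element is weighted by the gap to its successor in \<open>F\<close>, so the sum
  below \<open>a\<close> telescopes. Inserting elements in increasing order makes one gap appear at
  a time.\<close>

lemma ex_gap_weights:
  fixes F :: "'a::linordered_field set"
  assumes "finite F"
  shows "\<exists>w. (\<forall>f. w f \<ge> 0) \<and> (\<forall>a\<in>F. (\<Sum>f | f \<in> F \<and> f < a. w f) = a - Min F)"
  using assms
proof (induction rule: finite_linorder_max_induct)
  case empty
  show ?case by (intro exI[of _ "\<lambda>_. 0"]) auto
next
  case (insert b F)
  then obtain w where w0: "\<And>f. w f \<ge> 0"
    and w: "\<And>a. a \<in> F \<Longrightarrow> (\<Sum>f | f \<in> F \<and> f < a. w f) = a - Min F" by blast
  show ?case
  proof (cases "F = {}")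
    case True
    then show ?thesis by (intro exI[of _ "\<lambda>_. 0"]) auto
  next
    case False
    let ?m = "Max F"
    \<comment> \<open>The old maximum lies below no element of \<open>F\<close>, so changing its
      weight leaves all old sums intact; its new weight is the gap up to \<open>b\<close>.\<close>
    let ?w = "w(?m := b - ?m)"
    have m: "?m \<in> F" "\<And>f. f \<in> F \<Longrightarrow> f \<le> ?m" "?m < b"
      using insert False by auto
    have Min: "Min (insert b F) = Min F"
    proof -
      have "Min F \<le> ?m" using m(1) insert(1) by simp
      then have "Min F \<le> b" using m(3) by simp
      then show ?thesis using insert(1) False by (simp add: Min_insert min_absorb2 del: Min_le_iff)
    qed
    have old: "(\<Sum>f | f \<in> insert b F \<and> f < a. ?w f) = a - Min F" if "a \<in> F" for a
    proof -
      have "(\<Sum>f | f \<in> insert b F \<and> f < a. ?w f) = (\<Sum>f | f \<in> F \<and> f < a. w f)"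
        using that insert(2) m(2) by (intro sum.cong) force+
      then show ?thesis using w[OF that] by simp
    qed
    have "{f. f \<in> insert b F \<and> f < b} = insert ?m {f. f \<in> insert b F \<and> f < ?m}"
      using insert(2) m by force
    then have "(\<Sum>f | f \<in> insert b F \<and> f < b. ?w f)
        = ?w ?m + (\<Sum>f | f \<in> insert b F \<and> f < ?m. ?w f)"
      using insert(1) by simp
    also have "\<dots> = b - Min F" using old[OF m(1)] by simp
    finally have "(\<Sum>f | f \<in> insert b F \<and> f < b. ?w f) = b - Min F" .
    then have "\<forall>a\<in>insert b F. (\<Sum>f | f \<in> insert b F \<and> f < a. ?w f) = a - Min (insert b F)"
      unfolding Min using old by (intro ballI) (elim insertE, auto simp del: fun_upd_apply)
    moreover have "\<forall>f. ?w f \<ge> 0" using w0 m(3) by simp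
    ultimately show ?thesis by blast
  qed
qed

text \<open>Here \<open>y - \<theta>\<close> is \<open>\<lfloor>y\<rfloor>\<close> plus
  \<open>frac y - \<theta>\<close>, a number strictly between -1 and 1 whose ceiling is 1 if it is
  positive and 0 otherwise.\<close>

lemma ceiling_diff_eq_floor:
  fixes y \<theta> :: "'a::floor_ceiling"
  assumes "0 \<le> \<theta>" "\<theta> < 1"
  shows "\<lceil>y - \<theta>\<rceil> = \<lfloor>y\<rfloor> + (if \<theta> < frac y then 1 else 0)"
  using assms by (intro ceiling_unique) (auto simp: frac_def; linarith)+

text \<open>A discrete substitute for integrating over \<theta> in [0, 1). Since the ceiling jumps
  only when \<theta> passes \<open>frac y\<close>, it suffices that the thresholds below
  \<open>frac y\<close> have total weight \<open>frac y\<close>, which gap weights achieve.\<close>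

lemma ex_ceiling_average:
  fixes Y :: "'a::floor_ceiling set"
  assumes "finite Y"
  obtains F w where "finite F" "F \<subseteq> {0..<1}" "\<And>\<theta>. w \<theta> \<ge> 0" "sum w F = 1"
    "\<And>y. y \<in> Y \<Longrightarrow> (\<Sum>\<theta>\<in>F. w \<theta> * of_int \<lceil>y - \<theta>\<rceil>) = y"
proof -
  \<comment> \<open>Including 0 makes \<open>Min G = 0\<close>, so the weight below \<open>a\<close>
    is \<open>a\<close> itself; including 1 makes the weight of all thresholds below 1 equal to
    1.\<close>
  define G where "G = insert 0 (insert 1 (frac ` Y))"
  define F where "F = {f \<in> G. f < 1}"
  have fin: "finite G" "finite F" using assms by (auto simp: G_def F_def)
  have F: "F \<subseteq> {0..<1}" by (auto simp: F_def G_def frac_ge_0)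
  have "Min G = 0" using fin by (intro Min_eqI) (auto simp: G_def frac_ge_0)
  with ex_gap_weights[OF fin(1)] obtain w where w0: "\<And>f. w f \<ge> 0"
    and w: "\<And>a. a \<in> G \<Longrightarrow> (\<Sum>f | f \<in> G \<and> f < a. w f) = a" by auto
  have w1: "sum w F = 1" using w[of 1] by (simp add: F_def G_def)
  have "(\<Sum>\<theta>\<in>F. w \<theta> * of_int \<lceil>y - \<theta>\<rceil>) = y" if "y \<in> Y" for y
  proof -
    have "(\<Sum>\<theta>\<in>F. w \<theta> * of_int \<lceil>y - \<theta>\<rceil>)
        = (\<Sum>\<theta>\<in>F. of_int \<lfloor>y\<rfloor> * w \<theta> + (if \<theta> < frac y then w \<theta> else 0))"
    proof (rule sum.cong)
      fix \<theta> assume "\<theta> \<in> F"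
      then have "0 \<le> \<theta>" "\<theta> < 1" using F by auto
      then show "w \<theta> * of_int \<lceil>y - \<theta>\<rceil>
          = of_int \<lfloor>y\<rfloor> * w \<theta> + (if \<theta> < frac y then w \<theta> else 0)"
        by (simp add: ceiling_diff_eq_floor algebra_simps)
    qed simp
    also have "\<dots> = of_int \<lfloor>y\<rfloor> * sum w F + (\<Sum>\<theta> | \<theta> \<in> F \<and> \<theta> < frac y. w \<theta>)"
      using fin by (simp add: sum.distrib sum_distrib_left sum.inter_filter)
    also have "{\<theta>. \<theta> \<in> F \<and> \<theta> < frac y} = {f. f \<in> G \<and> f < frac y}"
      using frac_lt_1[of y] by (auto simp: F_def)
    also have "(\<Sum>f | f \<in> G \<and> f < frac y. w f) = frac y"
      using that by (intro w) (auto simp: G_def)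
    finally show ?thesis using w1 by (simp add: frac_def)
  qed
  then show ?thesis using that fin F w0 w1 by blast
qed

section \<open>Vectors indexed by a finite set\<close>

lemma lookup_scaleR: "(a *\<^sub>R v) \<bullet>\<bullet> t = a * v \<bullet>\<bullet> t"
proof -
  have "finite {i. a * v \<bullet>\<bullet> i \<noteq> 0}"
    by (rule finite_subset[of _ "Poly_Mapping.keys v"]) (auto simp: in_keys_iff)
  then show ?thesis by (simp add: scaleR_poly_mapping_def)
qed

lemma real_vecs_iff: "v \<in> real_vecs I \<longleftrightarrow> (\<forall>t. t \<notin> I \<longrightarrow> v \<bullet>\<bullet> t = 0)"
  unfolding real_vecs_def by (auto simp: subset_iff in_keys_iff)

lemma real_vecs_comb:
  "\<lbrakk>v \<in> real_vecs I; v' \<in> real_vecs I\<rbrakk> \<Longrightarrow> a *\<^sub>R v + b *\<^sub>R v' \<in> real_vecs I"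
  by (simp add: real_vecs_iff lookup_add lookup_scaleR)

text \<open>Cutting \<open>f\<close> off outside a finite \<open>I\<close> gives it finite support,
  so that \<open>Abs_poly_mapping\<close> represents exactly the truncated function.\<close>

definition vec_on :: "nat set \<Rightarrow> (nat \<Rightarrow> real) \<Rightarrow> (nat \<Rightarrow>\<^sub>0 real)" where
  "vec_on I f = Abs_poly_mapping (\<lambda>t. if t \<in> I then f t else 0)"

lemma lookup_vec_on:
  assumes "finite I"
  shows "vec_on I f \<bullet>\<bullet> t = (if t \<in> I then f t else 0)"
proof -
  have "finite {t. (if t \<in> I then f t else 0) \<noteq> 0}"
    by (rule finite_subset[OF _ assms]) auto
  then show ?thesis by (simp add: vec_on_def)
qed

lemma vec_on_in_real_vecs: "finite I \<Longrightarrow> vec_on I f \<in> real_vecs I"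
  by (simp add: real_vecs_iff lookup_vec_on)

lemma vec_on_in_binary_vecs:
  "\<lbrakk>finite I; \<And>t. t \<in> I \<Longrightarrow> f t \<in> {0, 1}\<rbrakk> \<Longrightarrow> vec_on I f \<in> binary_vecs I"
  by (simp add: binary_vecs_def vec_on_in_real_vecs lookup_vec_on)

text \<open>Lets a weighted sum of rounded vectors be checked coordinate by coordinate on
  \<open>I\<close>, since both sides vanish elsewhere.\<close>

lemma sum_vec_on_eq:
  assumes "finite I" "v \<in> real_vecs I" "\<And>t. t \<in> I \<Longrightarrow> (\<Sum>i\<in>A. w i * f i t) = v \<bullet>\<bullet> t"
  shows "(\<Sum>i\<in>A. w i *\<^sub>R vec_on I (f i)) = v"
proof (rule poly_mapping_eqI)
  fix t
  show "(\<Sum>i\<in>A. w i *\<^sub>R vec_on I (f i)) \<bullet>\<bullet> t = v \<bullet>\<bullet> t"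
    using assms
    by (cases "t \<in> I") (auto simp: lookup_sum lookup_scaleR lookup_vec_on real_vecs_iff)
qed

section \<open>The linear relaxation\<close>

text \<open>The right-hand side of the theorem, named so that its convexity and the two inclusions
  can be stated separately.\<close>

definition relaxed_schedules ::
  "nat \<Rightarrow> nat \<Rightarrow> nat \<Rightarrow> real \<Rightarrow> real \<Rightarrow> real \<Rightarrow> real \<Rightarrow> schedule set" where
  "relaxed_schedules T L l pmin pmax rmin rmax =
     {(p, r, x, u). p \<in> real_vecs {1..T} \<and> r \<in> real_vecs {1..T} \<and>
        x \<in> real_vecs {1..T} \<and> u \<in> real_vecs {2..T} \<and>
        startup_logic T x u \<and> min_up_time T L x u \<and> min_down_time T l x u \<and>
        startup_nonneg T u \<and>
        min_generation T pmin p x \<and> max_capacity T pmax p r x \<and>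
        reserve_limits T rmin rmax r x}"

lemma convex_comb_le:
  fixes a b :: real
  assumes "s \<le> t" "s' \<le> t'" "0 \<le> a" "0 \<le> b"
  shows "a * s + b * s' \<le> a * t + b * t'"
  using assms by (intro add_mono mult_left_mono)

text \<open>Every constraint is a linear inequality in the schedule, so two instances can be scaled
  by \<open>a\<close> and \<open>b\<close> and added.\<close>

lemma convex_relaxed_schedules: "convex (relaxed_schedules T L l pmin pmax rmin rmax)"
proof (rule convexI)
  fix y y' :: schedule and a b :: real
  assume y: "y \<in> relaxed_schedules T L l pmin pmax rmin rmax"
    and y': "y' \<in> relaxed_schedules T L l pmin pmax rmin rmax"
    and ab: "0 \<le> a" "0 \<le> b" "a + b = 1"
  obtain p r x u where yeq: "y = (p, r, x, u)" by (metis prod.collapse)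
  obtain p' r' x' u' where yeq': "y' = (p', r', x', u')" by (metis prod.collapse)
  note h = y[unfolded yeq relaxed_schedules_def, simplified]
  note h' = y'[unfolded yeq' relaxed_schedules_def, simplified]
  note lookup = lookup_add lookup_scaleR
  note comb = convex_comb_le[OF _ _ ab(1,2)]
  have "startup_logic T (a *\<^sub>R x + b *\<^sub>R x') (a *\<^sub>R u + b *\<^sub>R u')"
    unfolding startup_logic_def lookup
  proof
    fix t assume "t \<in> {2..T}"
    then have "x \<bullet>\<bullet> t - x \<bullet>\<bullet> (t - 1) \<le> u \<bullet>\<bullet> t" "x' \<bullet>\<bullet> t - x' \<bullet>\<bullet> (t - 1) \<le> u' \<bullet>\<bullet> t"
      using h h' by (simp_all add: startup_logic_def)
    from comb[OF this] show "a * x \<bullet>\<bullet> t + b * x' \<bullet>\<bullet> t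
        - (a * x \<bullet>\<bullet> (t - 1) + b * x' \<bullet>\<bullet> (t - 1)) \<le> a * u \<bullet>\<bullet> t + b * u' \<bullet>\<bullet> t"
      by (simp add: algebra_simps)
  qed
  moreover have "min_up_time T L (a *\<^sub>R x + b *\<^sub>R x') (a *\<^sub>R u + b *\<^sub>R u')"
    unfolding min_up_time_def lookup sum.distrib sum_distrib_left[symmetric]
    using h h' by (intro ballI comb) (simp_all add: min_up_time_def)
  moreover have "min_down_time T l (a *\<^sub>R x + b *\<^sub>R x') (a *\<^sub>R u + b *\<^sub>R u')"
    unfolding min_down_time_def lookup sum.distrib sum_distrib_left[symmetric]
  proof
    fix t assume "t \<in> {l+1..T}"
    then have "(\<Sum>i = t - l + 1..t. u \<bullet>\<bullet> i) \<le> 1 - x \<bullet>\<bullet> (t - l)"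
      "(\<Sum>i = t - l + 1..t. u' \<bullet>\<bullet> i) \<le> 1 - x' \<bullet>\<bullet> (t - l)"
      using h h' by (simp_all add: min_down_time_def)
    \<comment> \<open>This constraint has the constant term 1; it combines to \<open>a + b\<close>,
      which is then replaced by 1.\<close>
    from comb[OF this]
    have "a * (\<Sum>i = t - l + 1..t. u \<bullet>\<bullet> i) + b * (\<Sum>i = t - l + 1..t. u' \<bullet>\<bullet> i)
      \<le> (a + b) - (a * x \<bullet>\<bullet> (t - l) + b * x' \<bullet>\<bullet> (t - l))"
      by (simp add: algebra_simps)
    then show "a * (\<Sum>i = t - l + 1..t. u \<bullet>\<bullet> i) + b * (\<Sum>i = t - l + 1..t. u' \<bullet>\<bullet> i)
      \<le> 1 - (a * x \<bullet>\<bullet> (t - l) + b * x' \<bullet>\<bullet> (t - l))"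
      using ab(3) by simp
  qed
  moreover have "startup_nonneg T (a *\<^sub>R u + b *\<^sub>R u')"
    using h h' ab by (simp add: startup_nonneg_def lookup)
  moreover have "min_generation T pmin (a *\<^sub>R p + b *\<^sub>R p') (a *\<^sub>R x + b *\<^sub>R x')"
    unfolding min_generation_def lookup distrib_right mult.assoc
    using h h' by (intro ballI comb) (simp_all add: min_generation_def)
  moreover have "max_capacity T pmax (a *\<^sub>R p + b *\<^sub>R p') (a *\<^sub>R r + b *\<^sub>R r')
      (a *\<^sub>R x + b *\<^sub>R x')"
    unfolding max_capacity_def lookup
  proof
    fix t assume "t \<in> {1..T}"
    then have "p \<bullet>\<bullet> t + r \<bullet>\<bullet> t \<le> x \<bullet>\<bullet> t * pmax" "p' \<bullet>\<bullet> t + r' \<bullet>\<bullet> t \<le> x' \<bullet>\<bullet> t * pmax"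
      using h h' by (simp_all add: max_capacity_def)
    from comb[OF this] show "a * p \<bullet>\<bullet> t + b * p' \<bullet>\<bullet> t + (a * r \<bullet>\<bullet> t + b * r' \<bullet>\<bullet> t)
        \<le> (a * x \<bullet>\<bullet> t + b * x' \<bullet>\<bullet> t) * pmax"
      by (simp add: algebra_simps)
  qed
  moreover have "reserve_limits T rmin rmax (a *\<^sub>R r + b *\<^sub>R r') (a *\<^sub>R x + b *\<^sub>R x')"
    unfolding reserve_limits_def lookup distrib_right mult.assoc
    using h h' by (intro ballI conjI comb) (simp_all add: reserve_limits_def)
  ultimately show "a *\<^sub>R y + b *\<^sub>R y' \<in> relaxed_schedules T L l pmin pmax rmin rmax"
    using h h' unfolding relaxed_schedules_def yeq yeq'
    by (simp add: real_vecs_comb)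
qed

text \<open>The one relaxed constraint not listed for feasible schedules is
  \<open>startup_nonneg\<close>, and binary start-ups satisfy it.\<close>

lemma feasible_subset_relaxed:
  "feasible_schedules T L l pmin pmax rmin rmax \<subseteq> relaxed_schedules T L l pmin pmax rmin rmax"
  unfolding feasible_schedules_def relaxed_schedules_def binary_vecs_def startup_nonneg_def
  by fastforce

section \<open>Cumulative start-ups and shut-downs\<close>

lemma sum_startups_eq_diff:
  fixes U :: "nat \<Rightarrow> real"
  assumes "\<And>t. t \<in> {2..T} \<Longrightarrow> u \<bullet>\<bullet> t = U t - U (t - 1)" "1 \<le> s" "s \<le> t" "t \<le> T"
  shows "(\<Sum>i = s + 1..t. u \<bullet>\<bullet> i) = U t - U s"
proof -
  have "(\<Sum>i = s + 1..t. u \<bullet>\<bullet> i) = (\<Sum>i = Suc s..t. U i - U (i - 1))"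
    using assms by (intro sum.cong) auto
  also have "\<dots> = U t - U s" using assms(3) by (rule sum_telescope'')
  finally show ?thesis .
qed

text \<open>The difference \<open>u t - (x t - x (t - 1))\<close> equals
  \<open>V t - V (t - 1)\<close>, and a window sum of \<open>u\<close> telescopes to
  \<open>U t - U (t - k)\<close>; then \<open>U t\<close> cancels in the up-time constraint and
  \<open>U (t - l)\<close> in the down-time constraint. \<open>U\<close> and \<open>V\<close> are
  arbitrary so that the equivalences serve both the given point and its roundings.\<close>

lemma constraints_iff_cumulative:
  fixes U V :: "nat \<Rightarrow> real"
  assumes xUV: "\<forall>t\<in>{1..T}. x \<bullet>\<bullet> t = U t - V t"
    and uU: "\<forall>t\<in>{2..T}. u \<bullet>\<bullet> t = U t - U (t - 1)"
  shows startup_logic_iff: "startup_logic T x u \<longleftrightarrow> (\<forall>t\<in>{2..T}. V (t - 1) \<le> V t)"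
    and startup_nonneg_iff: "startup_nonneg T u \<longleftrightarrow> (\<forall>t\<in>{2..T}. U (t - 1) \<le> U t)"
    and min_up_time_iff: "min_up_time T L x u \<longleftrightarrow> (\<forall>t\<in>{L+1..T}. V t \<le> U (t - L))"
    and min_down_time_iff: "min_down_time T l x u \<longleftrightarrow> (\<forall>t\<in>{l+1..T}. U t \<le> 1 + V (t - l))"
proof -
  note x = bspec[OF xUV] and u = bspec[OF uU]
  show "startup_logic T x u \<longleftrightarrow> (\<forall>t\<in>{2..T}. V (t - 1) \<le> V t)"
    unfolding startup_logic_def
  proof (intro ball_cong refl)
    fix t assume t: "t \<in> {2..T}"
    then have "t \<in> {1..T}" "t - 1 \<in> {1..T}" by auto
    with t show "x \<bullet>\<bullet> t - x \<bullet>\<bullet> (t - 1) \<le> u \<bullet>\<bullet> t \<longleftrightarrow> V (t - 1) \<le> V t"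
      by (simp add: x u del: One_nat_def)
  qed
  show "startup_nonneg T u \<longleftrightarrow> (\<forall>t\<in>{2..T}. U (t - 1) \<le> U t)"
    unfolding startup_nonneg_def by (intro ball_cong refl) (auto simp: u)
  have sum: "(\<Sum>i = t - k + 1..t. u \<bullet>\<bullet> i) = U t - U (t - k)" if "t \<in> {k+1..T}" for t k
    using that by (intro sum_startups_eq_diff[OF u]) auto
  show "min_up_time T L x u \<longleftrightarrow> (\<forall>t\<in>{L+1..T}. V t \<le> U (t - L))"
    unfolding min_up_time_def by (intro ball_cong refl) (auto simp only: sum, auto simp: x)
  show "min_down_time T l x u \<longleftrightarrow> (\<forall>t\<in>{l+1..T}. U t \<le> 1 + V (t - l))"
    unfolding min_down_time_def
  proof (intro ball_cong refl)
    fix t assume t: "t \<in> {l+1..T}"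
    then have "t - l \<in> {1..T}" by auto
    then show "(\<Sum>i = t - l + 1..t. u \<bullet>\<bullet> i) \<le> 1 - x \<bullet>\<bullet> (t - l) \<longleftrightarrow> U t \<le> 1 + V (t - l)"
      unfolding sum[OF t] by (auto simp: x)
  qed
qed

lemma mono_on_atLeastAtMostI:
  fixes f :: "nat \<Rightarrow> 'a::order"
  assumes "\<And>t. t \<in> {Suc m..n} \<Longrightarrow> f (t - 1) \<le> f t"
  shows "mono_on {m..n} f"
proof (rule mono_onI)
  fix i j assume "i \<in> {m..n}" "j \<in> {m..n}" "i \<le> j"
  from this(3,1,2) show "f i \<le> f j"
  proof (induction rule: dec_induct)
    case (step k)
    then show ?case using assms[of "Suc k"] by (force intro: order_trans)
  qed simp
qed

text \<open>These are the bounds 0 \<le> x \<le> 1 and u \<le> 1, implicit in the relaxation and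
  needed for the rounded points to be binary. The up- and down-time constraints cover only part of
  the horizon; monotonicity carries them to the remaining periods.\<close>

lemma cumulative_bounds:
  fixes U V :: "nat \<Rightarrow> real"
  assumes "1 \<le> L" "L \<le> T - 1" "1 \<le> l" "l \<le> T - 1"
    and U: "mono_on {1..T} U" and V: "mono_on {1..T} V"
    and up: "\<forall>t\<in>{L+1..T}. V t \<le> U (t - L)"
    and down: "\<forall>t\<in>{l+1..T}. U t \<le> 1 + V (t - l)"
  shows "t \<in> {1..T} \<Longrightarrow> V t \<le> U t"
    and "t \<in> {1..T} \<Longrightarrow> U t \<le> 1 + V t"
    and "t \<in> {2..T} \<Longrightarrow> U t \<le> 1 + U (t - 1)"
proof -
  have Um: "U i \<le> U j" if "1 \<le> i" "i \<le> j" "j \<le> T" for i j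
    using that by (intro mono_onD[OF U]) auto
  have Vm: "V i \<le> V j" if "1 \<le> i" "i \<le> j" "j \<le> T" for i j
    using that by (intro mono_onD[OF V]) auto
  show VU: "V t \<le> U t" if t: "t \<in> {1..T}" for t
  proof -
    \<comment> \<open>The first period from \<open>t\<close> on where the up-time constraint is
      available; going back \<open>L\<close> periods from it ends in [1, t] because \<open>L\<close>
      is at least 1.\<close>
    let ?s = "max t (L + 1)"
    have "V t \<le> V ?s" using t assms(1,2) by (intro Vm) auto
    also have "\<dots> \<le> U (?s - L)" using t assms(1,2) by (intro bspec[OF up]) auto
    also have "\<dots> \<le> U t" using t assms(1,2) by (intro Um) auto
    finally show ?thesis .
  qed
  show "U t \<le> 1 + V t" if t: "t \<in> {1..T}" for t
  proof -
    \<comment> \<open>The down-time constraint at \<open>t + l\<close> looks back exactly to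
      \<open>t\<close>. Capping at \<open>T\<close> keeps the period in range and only moves the
      look-back earlier, where \<open>V\<close> is no larger.\<close>
    let ?s = "min (t + l) T"
    have "U t \<le> U ?s" using t assms(3,4) by (intro Um) auto
    also have "\<dots> \<le> 1 + V (?s - l)" using t assms(3,4) by (intro bspec[OF down]) auto
    also have "V (?s - l) \<le> V t" using t assms(3,4) by (intro Vm) auto
    finally show ?thesis by simp
  qed
  show "U t \<le> 1 + U (t - 1)" if t: "t \<in> {2..T}"
  proof -
    \<comment> \<open>Going back \<open>l\<close> periods from here ends in [1, t - 1], because
      \<open>l\<close> is at least 1 and \<open>t\<close> at least 2.\<close>
    let ?s = "max t (l + 1)"
    have "U t \<le> U ?s" using t assms(3,4) by (intro Um) auto
    also have "\<dots> \<le> 1 + V (?s - l)" using t assms(3,4) by (intro bspec[OF down]) auto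
    also have "V (?s - l) \<le> V (t - 1)" using t assms(3,4) by (intro Vm) auto
    also have "V (t - 1) \<le> U (t - 1)" using t by (intro VU) auto
    finally show ?thesis by simp
  qed
qed

section \<open>Rounding a relaxed point to binary schedules\<close>

lemma ceiling_diff_in_01:
  fixes y z :: "'a::floor_ceiling"
  assumes "z \<le> y" "y \<le> 1 + z"
  shows "\<lceil>y\<rceil> - \<lceil>z\<rceil> \<in> {0, 1}"
proof -
  have "\<lceil>z\<rceil> \<le> \<lceil>y\<rceil>" using assms(1) by (rule ceiling_mono)
  moreover have "\<lceil>y\<rceil> \<le> \<lceil>z + 1\<rceil>" using assms(2) by (intro ceiling_mono) (simp add: add.commute)
  ultimately show ?thesis by auto
qed

lemma of_int_ceiling_diff_le:
  fixes y z \<theta> :: "'a::floor_ceiling"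
  assumes "y \<le> z"
  shows "(of_int \<lceil>y - \<theta>\<rceil> :: 'a) \<le> of_int \<lceil>z - \<theta>\<rceil>"
  using assms by (simp add: ceiling_mono)

lemma of_int_ceiling_diff_le_add_one:
  fixes y z \<theta> :: "'a::floor_ceiling"
  assumes "y \<le> 1 + z"
  shows "(of_int \<lceil>y - \<theta>\<rceil> :: 'a) \<le> 1 + of_int \<lceil>z - \<theta>\<rceil>"
proof -
  have "\<lceil>y - \<theta>\<rceil> \<le> \<lceil>(z - \<theta>) + 1\<rceil>" using assms by (intro ceiling_mono) (simp add: algebra_simps)
  then have "\<lceil>y - \<theta>\<rceil> \<le> 1 + \<lceil>z - \<theta>\<rceil>" by simp
  then have "(of_int \<lceil>y - \<theta>\<rceil> :: 'a) \<le> of_int (1 + \<lceil>z - \<theta>\<rceil>)" by (simp only: of_int_le_iff)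
  then show ?thesis by simp
qed

text \<open>Using one \<theta> for all values of \<open>U\<close> and \<open>V\<close> preserves the
  difference constraints, so each \<theta> yields a feasible schedule; the weights of
  \<open>ex_ceiling_average\<close> then combine these schedules to the given point.\<close>

lemma relaxed_subset_hull:
  assumes TL: "1 \<le> L" "L \<le> T - 1" "1 \<le> l" "l \<le> T - 1"
  shows "relaxed_schedules T L l pmin pmax rmin rmax
    \<subseteq> convex hull (feasible_schedules T L l pmin pmax rmin rmax)"
proof (clarify)
  fix p r x u
  assume "(p, r, x, u) \<in> relaxed_schedules T L l pmin pmax rmin rmax"
  then have vecs: "p \<in> real_vecs {1..T}" "r \<in> real_vecs {1..T}"
      "x \<in> real_vecs {1..T}" "u \<in> real_vecs {2..T}"
    and cons: "startup_logic T x u" "min_up_time T L x u" "min_down_time T l x u"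
      "startup_nonneg T u"
    and gen: "min_generation T pmin p x" "max_capacity T pmax p r x"
      "reserve_limits T rmin rmax r x"
    by (simp_all add: relaxed_schedules_def)
  \<comment> \<open>At \<open>t = 1\<close> the sum is empty, so \<open>U 1 = x 1\<close> and
    \<open>V 1 = 0\<close>: being on initially counts as a start-up.\<close>
  define U where "U t = x \<bullet>\<bullet> 1 + (\<Sum>i = 2..t. u \<bullet>\<bullet> i)" for t
  define V where "V t = U t - x \<bullet>\<bullet> t" for t
  have x: "x \<bullet>\<bullet> t = U t - V t" for t by (simp add: V_def)
  have u: "u \<bullet>\<bullet> t = U t - U (t - 1)" if t: "t \<in> {2..T}" for t
  proof -
    obtain n where "t = Suc n" "2 \<le> Suc n" using t by (cases t) auto
    then show ?thesis by (simp add: U_def)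
  qed
  have "\<forall>t\<in>{1..T}. x \<bullet>\<bullet> t = U t - V t" "\<forall>t\<in>{2..T}. u \<bullet>\<bullet> t = U t - U (t - 1)"
    using x u by blast+
  note iff = constraints_iff_cumulative[OF this]
  have V_step: "\<And>t. t \<in> {2..T} \<Longrightarrow> V (t - 1) \<le> V t"
    and U_step: "\<And>t. t \<in> {2..T} \<Longrightarrow> U (t - 1) \<le> U t"
    and up: "\<forall>t\<in>{L+1..T}. V t \<le> U (t - L)"
    and down: "\<forall>t\<in>{l+1..T}. U t \<le> 1 + V (t - l)"
    using cons iff by blast+
  have mono: "mono_on {1..T} U" "mono_on {1..T} V"
    using U_step V_step by (auto intro!: mono_on_atLeastAtMostI simp: numeral_2_eq_2)
  note bounds = cumulative_bounds[OF TL mono up down]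
  obtain F w where F: "finite F" "F \<subseteq> {0..<1}" and w: "\<And>\<theta>::real. w \<theta> \<ge> 0" "sum w F = 1"
    and avg: "\<And>y. y \<in> U ` {1..T} \<union> V ` {1..T} \<Longrightarrow> (\<Sum>\<theta>\<in>F. w \<theta> * of_int \<lceil>y - \<theta>\<rceil>) = y"
    by (rule ex_ceiling_average[of "U ` {1..T} \<union> V ` {1..T}"]) auto
  define U' where "U' \<theta> t = (of_int \<lceil>U t - \<theta>\<rceil> :: real)" for \<theta> t
  define V' where "V' \<theta> t = (of_int \<lceil>V t - \<theta>\<rceil> :: real)" for \<theta> t
  define X where "X \<theta> t = U' \<theta> t - V' \<theta> t" for \<theta> t
  define xs where "xs \<theta> = vec_on {1..T} (X \<theta>)" for \<theta>
  define us where "us \<theta> = vec_on {2..T} (\<lambda>t. U' \<theta> t - U' \<theta> (t - 1))" for \<theta>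
  \<comment> \<open>Whenever the rounded unit is on, it produces \<open>p t / x t\<close>; as
    \<open>X \<theta> t\<close> averages to \<open>x t\<close>, the average output is
    \<open>p t\<close>. If \<open>x t = 0\<close>, the quotient is 0 by convention, and so is
    \<open>p t\<close>.\<close>
  define ps where "ps \<theta> = vec_on {1..T} (\<lambda>t. X \<theta> t * (p \<bullet>\<bullet> t / x \<bullet>\<bullet> t))" for \<theta>
  define rs where "rs \<theta> = vec_on {1..T} (\<lambda>t. X \<theta> t * (r \<bullet>\<bullet> t / x \<bullet>\<bullet> t))" for \<theta>
  have U'_avg: "(\<Sum>\<theta>\<in>F. w \<theta> * U' \<theta> t) = U t" if "t \<in> {1..T}" for t
    using that by (auto simp: U'_def intro!: avg)
  have V'_avg: "(\<Sum>\<theta>\<in>F. w \<theta> * V' \<theta> t) = V t" if "t \<in> {1..T}" for t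
    using that by (auto simp: V'_def intro!: avg)
  have X_avg: "(\<Sum>\<theta>\<in>F. w \<theta> * X \<theta> t) = x \<bullet>\<bullet> t" if "t \<in> {1..T}" for t
    using U'_avg[OF that] V'_avg[OF that] x[of t]
    by (simp add: X_def right_diff_distrib sum_subtractf)
  have x_nonneg: "0 \<le> x \<bullet>\<bullet> t" if "t \<in> {1..T}" for t
    using bounds(1)[OF that] x[of t] by simp
  \<comment> \<open>The common shift keeps \<open>V t \<le> U t \<le> 1 + V t\<close>, so the two
    integer ceilings differ by 0 or 1.\<close>
  have X_01: "X \<theta> t \<in> {0, 1}" if "t \<in> {1..T}" for \<theta> t
    using ceiling_diff_in_01[of "V t - \<theta>" "U t - \<theta>"] bounds(1,2)[OF that]
    by (auto simp: X_def U'_def V'_def)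
  \<comment> \<open>If \<open>x t = 0\<close>, then \<open>U t\<close> and \<open>V t\<close>
    coincide and round to the same integer. Hence division by \<open>x t\<close> is legitimate
    wherever the rounded unit is on.\<close>
  have X_cases: "X \<theta> t = 0 \<or> X \<theta> t = 1 \<and> 0 < x \<bullet>\<bullet> t" if "t \<in> {1..T}" for \<theta> t
    using X_01[OF that, of \<theta>] x_nonneg[OF that] x[of t]
    by (cases "x \<bullet>\<bullet> t = 0") (auto simp: X_def U'_def V'_def)
  have feasible: "(ps \<theta>, rs \<theta>, xs \<theta>, us \<theta>) \<in> feasible_schedules T L l pmin pmax rmin rmax" for \<theta>
  proof -
    have xs: "\<forall>t\<in>{1..T}. xs \<theta> \<bullet>\<bullet> t = U' \<theta> t - V' \<theta> t"
      by (simp add: xs_def lookup_vec_on X_def)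
    have us: "\<forall>t\<in>{2..T}. us \<theta> \<bullet>\<bullet> t = U' \<theta> t - U' \<theta> (t - 1)"
      by (simp add: us_def lookup_vec_on)
    note iff' = constraints_iff_cumulative[OF xs us]
    have "startup_logic T (xs \<theta>) (us \<theta>)" "min_up_time T L (xs \<theta>) (us \<theta>)"
      "min_down_time T l (xs \<theta>) (us \<theta>)"
      unfolding iff'(1,3,4) U'_def V'_def
      using V_step up down
      by (auto intro!: of_int_ceiling_diff_le of_int_ceiling_diff_le_add_one
          simp del: of_int_le_iff One_nat_def)
    moreover have "xs \<theta> \<in> binary_vecs {1..T}"
      unfolding xs_def using X_01 by (intro vec_on_in_binary_vecs) auto
    \<comment> \<open>Monotonicity of \<open>U\<close> gives the lower bound 0 on the rounded
      start-up, the third part of \<open>bounds\<close> the upper bound 1.\<close>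
    moreover have "us \<theta> \<in> binary_vecs {2..T}"
      unfolding us_def
    proof (rule vec_on_in_binary_vecs)
      fix t assume "t \<in> {2..T}"
      then show "U' \<theta> t - U' \<theta> (t - 1) \<in> {0, 1}"
        using ceiling_diff_in_01[of "U (t - 1) - \<theta>" "U t - \<theta>"] bounds(3) U_step
        by (auto simp: U'_def)
    qed simp
    \<comment> \<open>For this and the next two constraints: both sides are 0 when the rounded unit
      is off; when it is on, the original inequality is divided by \<open>x t > 0\<close>.\<close>
    moreover have "min_generation T pmin (ps \<theta>) (xs \<theta>)"
      unfolding min_generation_def
    proof
      fix t assume t: "t \<in> {1..T}"
      then have "x \<bullet>\<bullet> t * pmin \<le> p \<bullet>\<bullet> t" using gen(1) by (simp add: min_generation_def)
      then show "xs \<theta> \<bullet>\<bullet> t * pmin \<le> ps \<theta> \<bullet>\<bullet> t"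
        using X_cases[OF t, of \<theta>] t by (auto simp: xs_def ps_def lookup_vec_on field_simps)
    qed
    moreover have "max_capacity T pmax (ps \<theta>) (rs \<theta>) (xs \<theta>)"
      unfolding max_capacity_def
    proof
      fix t assume t: "t \<in> {1..T}"
      then have "p \<bullet>\<bullet> t + r \<bullet>\<bullet> t \<le> x \<bullet>\<bullet> t * pmax" using gen(2) by (simp add: max_capacity_def)
      then show "ps \<theta> \<bullet>\<bullet> t + rs \<theta> \<bullet>\<bullet> t \<le> xs \<theta> \<bullet>\<bullet> t * pmax"
        using X_cases[OF t, of \<theta>] t
        by (auto simp: xs_def ps_def rs_def lookup_vec_on field_simps)
    qed
    moreover have "reserve_limits T rmin rmax (rs \<theta>) (xs \<theta>)"
      unfolding reserve_limits_def
    proof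
      fix t assume t: "t \<in> {1..T}"
      then have "x \<bullet>\<bullet> t * rmin \<le> r \<bullet>\<bullet> t" "r \<bullet>\<bullet> t \<le> x \<bullet>\<bullet> t * rmax"
        using gen(3) by (simp_all add: reserve_limits_def)
      then show "xs \<theta> \<bullet>\<bullet> t * rmin \<le> rs \<theta> \<bullet>\<bullet> t \<and> rs \<theta> \<bullet>\<bullet> t \<le> xs \<theta> \<bullet>\<bullet> t * rmax"
        using X_cases[OF t, of \<theta>] t by (auto simp: xs_def rs_def lookup_vec_on field_simps)
    qed
    moreover have "ps \<theta> \<in> real_vecs {1..T}" "rs \<theta> \<in> real_vecs {1..T}"
      by (simp_all add: ps_def rs_def vec_on_in_real_vecs)
    ultimately show ?thesis by (simp add: feasible_schedules_def)
  qed
  have scaled_avg: "(\<Sum>\<theta>\<in>F. w \<theta> * (X \<theta> t * (b / x \<bullet>\<bullet> t))) = b"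
    if "t \<in> {1..T}" "x \<bullet>\<bullet> t = 0 \<Longrightarrow> b = 0" for t b
  proof -
    have "(\<Sum>\<theta>\<in>F. w \<theta> * (X \<theta> t * (b / x \<bullet>\<bullet> t))) = (\<Sum>\<theta>\<in>F. w \<theta> * X \<theta> t) * (b / x \<bullet>\<bullet> t)"
      unfolding sum_distrib_right by (simp only: mult.assoc)
    then show ?thesis using X_avg[OF that(1)] that(2) by auto
  qed
  \<comment> \<open>With \<open>x t = 0\<close> the reserve limits force \<open>r t = 0\<close>, and
    then the generation limits squeeze \<open>p t\<close> between 0 and 0.\<close>
  have off: "p \<bullet>\<bullet> t = 0 \<and> r \<bullet>\<bullet> t = 0" if "t \<in> {1..T}" "x \<bullet>\<bullet> t = 0" for t
  proof -
    have "x \<bullet>\<bullet> t * pmin \<le> p \<bullet>\<bullet> t" "p \<bullet>\<bullet> t + r \<bullet>\<bullet> t \<le> x \<bullet>\<bullet> t * pmax"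
      "x \<bullet>\<bullet> t * rmin \<le> r \<bullet>\<bullet> t" "r \<bullet>\<bullet> t \<le> x \<bullet>\<bullet> t * rmax"
      using gen that(1) unfolding min_generation_def max_capacity_def reserve_limits_def by blast+
    then show ?thesis using that(2) by simp
  qed
  have "(\<Sum>\<theta>\<in>F. w \<theta> *\<^sub>R ps \<theta>) = p" "(\<Sum>\<theta>\<in>F. w \<theta> *\<^sub>R rs \<theta>) = r"
    unfolding ps_def rs_def using vecs off by (intro sum_vec_on_eq scaled_avg; simp)+
  moreover have "(\<Sum>\<theta>\<in>F. w \<theta> *\<^sub>R xs \<theta>) = x"
    unfolding xs_def using vecs by (intro sum_vec_on_eq X_avg) simp_all
  moreover have "(\<Sum>\<theta>\<in>F. w \<theta> *\<^sub>R us \<theta>) = u"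
    unfolding us_def
  proof (rule sum_vec_on_eq)
    fix t assume t: "t \<in> {2..T}"
    then have "t \<in> {1..T}" "t - 1 \<in> {1..T}" by auto
    with t show "(\<Sum>\<theta>\<in>F. w \<theta> * (U' \<theta> t - U' \<theta> (t - 1))) = u \<bullet>\<bullet> t"
      by (simp add: u U'_avg right_diff_distrib sum_subtractf del: One_nat_def)
  qed (use vecs in simp_all)
  ultimately have "(\<Sum>\<theta>\<in>F. w \<theta> *\<^sub>R (ps \<theta>, rs \<theta>, xs \<theta>, us \<theta>)) = (p, r, x, u)"
    by (simp add: prod_eq_iff fst_sum snd_sum)
  moreover have "(\<Sum>\<theta>\<in>F. w \<theta> *\<^sub>R (ps \<theta>, rs \<theta>, xs \<theta>, us \<theta>))
      \<in> convex hull (feasible_schedules T L l pmin pmax rmin rmax)"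
    using F(1) w by (intro convex_sum) (auto intro!: hull_inc feasible)
  ultimately show "(p, r, x, u) \<in> convex hull (feasible_schedules T L l pmin pmax rmin rmax)"
    by simp
qed

theorem mainTheorem5:
  fixes T L l :: nat and pmin pmax rmin rmax :: real
  assumes "T \<ge> 2"
    and "1 \<le> L" and "L \<le> T - 1"
    and "1 \<le> l" and "l \<le> T - 1"
    and "0 \<le> pmin" and "pmin \<le> pmax"
    and "0 \<le> rmin" and "rmin \<le> rmax"
  shows "convex hull (feasible_schedules T L l pmin pmax rmin rmax) =
     {(p, r, x, u). p \<in> real_vecs {1..T} \<and> r \<in> real_vecs {1..T} \<and>
        x \<in> real_vecs {1..T} \<and> u \<in> real_vecs {2..T} \<and>
        startup_logic T x u \<and> min_up_time T L x u \<and> min_down_time T l x u \<and>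
        startup_nonneg T u \<and>
        min_generation T pmin p x \<and> max_capacity T pmax p r x \<and>
        reserve_limits T rmin rmax r x}"
  unfolding relaxed_schedules_def[symmetric]
proof (rule antisym)
  show "convex hull (feasible_schedules T L l pmin pmax rmin rmax)
    \<subseteq> relaxed_schedules T L l pmin pmax rmin rmax"
    by (intro hull_minimal feasible_subset_relaxed convex_relaxed_schedules)
  show "relaxed_schedules T L l pmin pmax rmin rmax
    \<subseteq> convex hull (feasible_schedules T L l pmin pmax rmin rmax)"
    using assms by (intro relaxed_subset_hull)
qed

end
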